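(* The following hold. (a) $\omega_1\leq\lambda(\mathcal{I})\leq\mathrm{add}(\mathcal{I}\text{QN-space})\leq\mathfrak{d}$ for every weak P-ideal $\mathcal{I}$ on $\omega$. (b) $\omega_1\leq\mathrm{add}(\mathcal{I}\text{QN-space})\leq\mathfrak{b}$ for every ideal $\mathcal{I}$ on $\omega$ which is $\leq_K$-below some $F_\sigma$ ideal. (c) $\lambda(\mathcal{I})=\mathrm{add}(\mathcal{I}\text{QN-space})=\mathfrak{b}$ for every P-ideal $\mathcal{I}$ on $\omega$ which is $\leq_K$-below some $F_\sigma$ ideal. In particular, $\lambda(\mathcal{I})=\mathrm{add}(\mathcal{I}\text{QN-space})=\mathfrak{b}$ for every analytic P-ideal $\mathcal I$ on $\omega$ generated by an unbounded submeasure.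
   Context: An ideal on $\omega$ is a proper subfamily of $\mathcal{P}(\omega)$ closed under finite unions and subsets and containing all finite sets. $\mathcal I$ is a weak P-ideal if for every partition $\{A_n:n\in\omega\}\subseteq\mathcal I$ of $\omega$ there is $A\notin\mathcal I$ with $A_n\cap A$ finite for all $n$; it is a P-ideal if for every $\{A_n:n\in\omega\}\subseteq\mathcal I$ there is $A\in\mathcal I$ with $A_n\setminus A$ finite for all $n$. $F_\sigma$ and analytic refer to the topology on $\mathcal P(\omega)\cong 2^\omega$. $\mathcal I\leq_K\mathcal J$ ($\mathcal I$ is $\leq_K$-below $\mathcal J$) means that there is $f:\omega\to\omega$ with $f^{-1}[A]\in\mathcal J$ for all $A\in\mathcal I$. A lower semicontinuous submeasure on $\omega$ is a map $\phi:\mathcal P(\omega)\to[0,\infty]$ with $\phi(\emptyset)=0$, $\phi(A)\le\phi(A\cup B)\le\phi(A)+\phi(B)$, $\phi(\{n\})<\infty$ for all $n\in\omega$, and $\phi(A)=\lim_{n}\phi(A\cap\{0,\dots,n\})$ for all $A$. $\mathrm{Exh}(\phi)=\{A\subseteq\omega:\lim_n\phi(A\cap\{n,n+1,\dots\})=0\}$. An analytic P-ideal $\mathcal I$ is generated by an unbounded submeasure if $\mathcal I=\mathrm{Exh}(\phi)$ for some lower semicontinuous submeasure $\phi$ with $\phi(\omega)=\infty$. $\mathcal P_{\mathcal I}$ is the family of all partitions $(A_n)_{n\in\omega}$ of $\omega$ into (possibly empty) sets belonging to $\mathcal I$, and $$\lambda(\mathcal I)=\min\Big\{|\mathcal A|:\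 \mathcal A\subseteq\mathcal P_{\mathcal I}\ \wedge\ \forall_{(B_n)\in\mathcal P_{\mathcal I}}\ \exists_{(A_n)\in\mathcal A}\ \bigcup_{n\in\omega}\Big(B_n\cap\bigcup_{k<n}A_k\Big)\notin\mathcal I\Big\}.$$ A sequence of reals $(x_n)$ is $\mathcal I$-convergent to $x$ if $\{n:|x_n-x|\ge\varepsilon\}\in\mathcal I$ for all $\varepsilon>0$. A sequence $(f_n)\subseteq\mathbb R^X$ $\mathcal I$QN-converges to $f\in\mathbb R^X$ if there are positive reals $\varepsilon_n$, with $(\varepsilon_n)$ $\mathcal I$-convergent to $0$, such that $\{n:|f_n(x)-f(x)|\ge\varepsilon_n\}\in\mathcal I$ for each $x\in X$. A topological space $X$ is an $\mathcal I$QN-space if every sequence of continuous functions $f_n:X\to\mathbb R$ converging pointwise to $0$ $\mathcal I$QN-converges to $0$. $\mathrm{add}(\mathcal I\text{QN-space})$ is the minimal cardinal $\kappa$ such that there is a perfectly normal space which is not an $\mathcal I$QN-space but can be expressed as a union of $\kappa$ many (subspaces that are) $\mathcal I$QN-spaces. $\mathfrak b$ and $\mathfrak d$ are the usual bounding and dominating numbers. *)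

theory Defs
  imports "HOL-Analysis.Analysis"
begin

unbundle cardinal_syntax

section \<open>Ideals on \<open>\<omega>\<close>\<close>

definition ideal_on_omega :: "nat set set \<Rightarrow> bool" where
  "ideal_on_omega I \<longleftrightarrow>
     UNIV \<notin> I \<and>
     (\<forall>A\<in>I. \<forall>B\<in>I. A \<union> B \<in> I) \<and>
     (\<forall>A\<in>I. \<forall>B. B \<subseteq> A \<longrightarrow> B \<in> I) \<and>
     (\<forall>A. finite A \<longrightarrow> A \<in> I)"

definition ideal_partitions :: "nat set set \<Rightarrow> (nat \<Rightarrow> nat set) set" where
  "ideal_partitions I =
     {A. disjoint_family A \<and> (\<Union>n. A n) = UNIV \<and> (\<forall>n. A n \<in> I)}"

definition weak_P_ideal :: "nat set set \<Rightarrow> bool" where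
  "weak_P_ideal I \<longleftrightarrow> ideal_on_omega I \<and>
     (\<forall>P\<in>ideal_partitions I. \<exists>A. A \<notin> I \<and> (\<forall>n. finite (P n \<inter> A)))"

definition P_ideal :: "nat set set \<Rightarrow> bool" where
  "P_ideal I \<longleftrightarrow> ideal_on_omega I \<and>
     (\<forall>S :: nat \<Rightarrow> nat set. (\<forall>n. S n \<in> I) \<longrightarrow> (\<exists>A\<in>I. \<forall>n. finite (S n - A)))"

text \<open>The topology of \<open>P(\<omega>)\<close>, transported from \<open>2\<^sup>\<omega>\<close> along characteristic functions.\<close>

definition powerset_topology :: "nat set topology" where
  "powerset_topology =
     pullback_topology UNIV (\<lambda>A n. n \<in> A)
       (product_topology (\<lambda>_::nat. discrete_topology (UNIV :: bool set)) UNIV)"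

definition F_sigma_ideal :: "nat set set \<Rightarrow> bool" where
  "F_sigma_ideal I \<longleftrightarrow> ideal_on_omega I \<and> fsigma_in powerset_topology I"

text \<open>Analytic: a continuous image of the Baire space (ideals are never empty).\<close>

definition analytic_ideal :: "nat set set \<Rightarrow> bool" where
  "analytic_ideal I \<longleftrightarrow> ideal_on_omega I \<and>
     (\<exists>f. continuous_map (product_topology (\<lambda>_::nat. discrete_topology (UNIV :: nat set)) UNIV)
            powerset_topology f \<and> range f = I)"

definition katetov_below :: "nat set set \<Rightarrow> nat set set \<Rightarrow> bool" where
  "katetov_below I J \<longleftrightarrow> (\<exists>f :: nat \<Rightarrow> nat. \<forall>A\<in>I. f -` A \<in> J)"

definition lsc_submeasure :: "(nat set \<Rightarrow> ennreal) \<Rightarrow> bool" where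
  "lsc_submeasure \<phi> \<longleftrightarrow>
     \<phi> {} = 0 \<and>
     (\<forall>A B. \<phi> A \<le> \<phi> (A \<union> B) \<and> \<phi> (A \<union> B) \<le> \<phi> A + \<phi> B) \<and>
     (\<forall>n. \<phi> {n} < \<infinity>) \<and>
     (\<forall>A. (\<lambda>n. \<phi> (A \<inter> {..n})) \<longlonglongrightarrow> \<phi> A)"

definition Exh :: "(nat set \<Rightarrow> ennreal) \<Rightarrow> nat set set" where
  "Exh \<phi> = {A. (\<lambda>n. \<phi> (A \<inter> {n..})) \<longlonglongrightarrow> 0}"

definition generated_by_unbounded_submeasure :: "nat set set \<Rightarrow> bool" where
  "generated_by_unbounded_submeasure I \<longleftrightarrow>
     (\<exists>\<phi>. lsc_submeasure \<phi> \<and> \<phi> UNIV = \<infinity> \<and> I = Exh \<phi>)"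


section \<open>\<open>I\<close>QN-spaces\<close>

definition ideal_convergent :: "nat set set \<Rightarrow> (nat \<Rightarrow> real) \<Rightarrow> real \<Rightarrow> bool" where
  "ideal_convergent I x l \<longleftrightarrow> (\<forall>e>0. {n. \<bar>x n - l\<bar> \<ge> e} \<in> I)"

definition IQN_converges ::
  "nat set set \<Rightarrow> 'a set \<Rightarrow> (nat \<Rightarrow> 'a \<Rightarrow> real) \<Rightarrow> ('a \<Rightarrow> real) \<Rightarrow> bool" where
  "IQN_converges I S f g \<longleftrightarrow>
     (\<exists>\<epsilon> :: nat \<Rightarrow> real. (\<forall>n. \<epsilon> n > 0) \<and> ideal_convergent I \<epsilon> 0 \<and>
        (\<forall>x\<in>S. {n. \<bar>f n x - g x\<bar> \<ge> \<epsilon> n} \<in> I))"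

definition IQN_space :: "nat set set \<Rightarrow> 'a topology \<Rightarrow> bool" where
  "IQN_space I X \<longleftrightarrow>
     (\<forall>f :: nat \<Rightarrow> 'a \<Rightarrow> real.
        (\<forall>n. continuous_map X euclideanreal (f n)) \<and>
        (\<forall>x\<in>topspace X. (\<lambda>n. f n x) \<longlonglongrightarrow> 0)
        \<longrightarrow> IQN_converges I (topspace X) f (\<lambda>_. 0))"

definition perfectly_normal_space :: "'a topology \<Rightarrow> bool" where
  "perfectly_normal_space X \<longleftrightarrow>
     t1_space X \<and> normal_space X \<and> (\<forall>C. closedin X C \<longrightarrow> gdelta_in X C)"


section \<open>Cardinal invariants\<close>

text \<open>\<open>min_card P\<close> is the least cardinality of a set satisfying \<open>P\<close>. It is meaningful only if
  some set satisfies \<open>P\<close>, so for invariants for which this is not evident the existence of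
  such a set has to be asserted separately.\<close>

definition min_card :: "('a set \<Rightarrow> bool) \<Rightarrow> 'a rel" where
  "min_card P = |SOME S. P S \<and> (\<forall>T. P T \<longrightarrow> |S| \<le>o |T| )|"

definition omega_1 :: "nat set rel" where
  "omega_1 = cardSuc natLeq"

definition eventually_le :: "(nat \<Rightarrow> nat) \<Rightarrow> (nat \<Rightarrow> nat) \<Rightarrow> bool" where
  "eventually_le f g \<longleftrightarrow> (\<forall>\<^sub>F n in sequentially. f n \<le> g n)"

definition bounding_number :: "(nat \<Rightarrow> nat) rel" where
  "bounding_number = min_card (\<lambda>F. \<not> (\<exists>g. \<forall>f\<in>F. eventually_le f g))"

definition dominating_number :: "(nat \<Rightarrow> nat) rel" where
  "dominating_number = min_card (\<lambda>F. \<forall>g. \<exists>f\<in>F. eventually_le g f)"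

definition lambda_witness :: "nat set set \<Rightarrow> (nat \<Rightarrow> nat set) set \<Rightarrow> bool" where
  "lambda_witness I \<A> \<longleftrightarrow>
     \<A> \<subseteq> ideal_partitions I \<and>
     (\<forall>B\<in>ideal_partitions I. \<exists>A\<in>\<A>. (\<Union>n. B n \<inter> (\<Union>k<n. A k)) \<notin> I)"

definition lambda_inv :: "nat set set \<Rightarrow> (nat \<Rightarrow> nat set) rel" where
  "lambda_inv I = min_card (lambda_witness I)"

text \<open>A family \<open>\<X>\<close> of \<open>I\<close>QN-subspaces covering a perfectly normal space that is not an
  \<open>I\<close>QN-space.\<close>

definition add_IQN_witness :: "nat set set \<Rightarrow> 'a set set \<Rightarrow> bool" where
  "add_IQN_witness I \<X> \<longleftrightarrow>
     (\<exists>X. topspace X = \<Union>\<X> \<and> perfectly_normal_space X \<and> \<not> IQN_space I X \<and>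
          (\<forall>Y\<in>\<X>. IQN_space I (subtopology X Y)))"

text \<open>HOL cannot quantify over all topological spaces within one formula, so the type argument
  \<open>'a\<close> supplies the universe of points: the minimum ranges over all topologies on all subsets of
  \<open>'a\<close>. Statements about add(\<open>I\<close>QN-space) are made for every type \<open>'a\<close> with at least continuum
  many elements, so that spaces of every cardinality are covered. The value does not depend on
  such \<open>'a\<close>: if a sequence \<open>f\<close> shows that \<open>X\<close> is not an \<open>I\<close>QN-space, then neither is the image of
  \<open>X\<close> in \<open>\<real>\<^sup>\<omega>\<close> under \<open>x \<mapsto> (f n x)\<^sub>n\<close>, while images of \<open>I\<close>QN-subspaces are \<open>I\<close>QN-spaces.\<close>

definition add_IQN :: "'a itself \<Rightarrow> nat set set \<Rightarrow> 'a set rel" where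
  "add_IQN _ I = min_card (add_IQN_witness I :: 'a set set \<Rightarrow> bool)"

definition lambda_exists :: "nat set set \<Rightarrow> bool" where
  "lambda_exists I \<longleftrightarrow> (\<exists>\<A>. lambda_witness I \<A>)"

definition add_IQN_exists :: "'a itself \<Rightarrow> nat set set \<Rightarrow> bool" where
  "add_IQN_exists _ I \<longleftrightarrow> (\<exists>\<X> :: 'a set set. add_IQN_witness I \<X>)"

end

theory Submission
  imports Defs "HOL-Library.Countable_Set_Type"
begin

text \<open>
  A partition of \<open>\<omega>\<close> into sets of \<open>I\<close> is the same thing as a function \<open>a : \<omega> \<rightarrow> \<omega>\<close> with fibres in
  \<open>I\<close>; in these terms \<open>\<lambda>(I)\<close> is the least size of a family of such functions without a common
  lower bound modulo \<open>I\<close>, and \<open>I\<close>QN-convergence means that the rates of convergence have such a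
  lower bound. Hence \<open>\<lambda>(I) \<le> add(I\<close>QN-space\<open>)\<close>, and a diagonal argument gives \<open>\<omega>\<^sub>1 \<le> \<lambda>(I)\<close>.

  Conversely, a family \<open>H\<close> of finite-to-one functions without a common lower bound, regarded as a
  discrete space, is not an \<open>I\<close>QN-space, but it is the union of its points. The inverses
  \<open>m \<mapsto> min {k. m \<le> g k + k}\<close> of the functions \<open>g\<close> in a dominating (unbounded) family form such an
  \<open>H\<close>. For dominating families one uses a set outside \<open>I\<close> on which a given function is
  finite-to-one. For unbounded ones and an \<open>F\<^sub>\<sigma>\<close> ideal \<open>J\<close> one chooses, by compactness, finite sets
  \<open>s\<^sub>k\<close> avoiding the \<open>k\<close>-th fibres such that no set in \<open>J\<close> contains infinitely many of them.
  In a \<open>P\<close>-ideal every function with fibres in \<open>I\<close> is finite-to-one off a set of \<open>I\<close>, and this gives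
  \<open>\<bb> \<le> \<lambda>(I)\<close>.
\<close>

section \<open>Least cardinalities\<close>

text \<open>The cardinals of the sets satisfying \<open>P\<close> form a nonempty class of
  well-orders, which has a least member. So the \<open>SOME\<close> in \<open>min_card\<close> picks
  a genuine minimum once a single witness exists.\<close>

lemma min_card_attained:
  assumes "P T"
  obtains S where "P S" "min_card P = |S|" "\<And>T. P T \<Longrightarrow> |S| \<le>o |T|"
proof -
  have "\<exists>r\<in>card_of ` {S. P S}. \<forall>r'\<in>card_of ` {S. P S}. r \<le>o r'"
    using assms by (intro exists_minim_Well_order) (auto intro: card_of_Well_order)
  then have "\<exists>S. P S \<and> (\<forall>T. P T \<longrightarrow> |S| \<le>o |T| )"
    by auto
  from someI_ex[OF this] show thesis
    by (intro that[of "SOME S. P S \<and> (\<forall>T. P T \<longrightarrow> |S| \<le>o |T| )"]) (auto simp: min_card_def)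
qed

lemma min_card_le: "P T \<Longrightarrow> min_card P \<le>o |T|"
  by (metis min_card_attained)

lemma min_card_mono:
  assumes "Q T" and "\<And>T. Q T \<Longrightarrow> \<exists>S. P S \<and> |S| \<le>o |T|"
  shows "min_card P \<le>o min_card Q"
  using assms by (metis min_card_attained min_card_le ordLeq_transitive)

lemma omega_1_le_card_of_iff: "omega_1 \<le>o |S| \<longleftrightarrow> uncountable S"
proof -
  have "omega_1 \<le>o |S| \<longleftrightarrow> natLeq <o |S|"
    unfolding omega_1_def
    by (rule cardSuc_ordLess_ordLeq[OF natLeq_Card_order card_of_Card_order, symmetric])
  also have "\<dots> \<longleftrightarrow> uncountable S"
    by (simp add: countable_card_le_natLeq not_ordLeq_iff_ordLess natLeq_Well_order card_of_Well_order)
  finally show ?thesis .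
qed


section \<open>Functions with fibres in an ideal\<close>

lemma ideal_Un: "ideal_on_omega I \<Longrightarrow> A \<in> I \<Longrightarrow> B \<in> I \<Longrightarrow> A \<union> B \<in> I"
  and ideal_subset: "ideal_on_omega I \<Longrightarrow> A \<in> I \<Longrightarrow> B \<subseteq> A \<Longrightarrow> B \<in> I"
  and ideal_finite: "ideal_on_omega I \<Longrightarrow> finite B \<Longrightarrow> B \<in> I"
  and ideal_UNIV: "ideal_on_omega I \<Longrightarrow> UNIV \<notin> I"
  unfolding ideal_on_omega_def by blast+

lemma ideal_UN_finite:
  assumes "ideal_on_omega I" "finite K" "\<And>k. k \<in> K \<Longrightarrow> A k \<in> I"
  shows "(\<Union>k\<in>K. A k) \<in> I"
  using assms(2,3)
  by (induction K rule: finite_induct) (auto intro: ideal_Un ideal_finite assms(1))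

text \<open>Initial segments replace single fibres, which is equivalent because \<open>I\<close> is
  closed under finite unions. In this form the condition says that \<open>a\<close> tends to
  infinity along the dual filter of \<open>I\<close>.\<close>

definition ideal_to_one :: "nat set set \<Rightarrow> (nat \<Rightarrow> nat) \<Rightarrow> bool" where
  "ideal_to_one I a \<longleftrightarrow> (\<forall>k. {m. a m \<le> k} \<in> I)"

text \<open>Unbounded means from below: the functions tend to infinity along \<open>I\<close>, and
  no function doing so stays below all of them modulo \<open>I\<close>.\<close>

definition unbounded_family :: "nat set set \<Rightarrow> (nat \<Rightarrow> nat) set \<Rightarrow> bool" where
  "unbounded_family I H \<longleftrightarrow> (\<forall>a\<in>H. ideal_to_one I a) \<and>
     (\<forall>b. ideal_to_one I b \<longrightarrow> (\<exists>a\<in>H. {m. a m < b m} \<notin> I))"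

definition fibres :: "(nat \<Rightarrow> nat) \<Rightarrow> nat \<Rightarrow> nat set" where
  "fibres a k = {m. a m = k}"

lemma ideal_partitions_eq:
  assumes "ideal_on_omega I"
  shows "ideal_partitions I = fibres ` {a. ideal_to_one I a}"
proof (intro equalityI subsetI)
  fix A assume "A \<in> ideal_partitions I"
  then have disj: "disjoint_family A" and cover: "(\<Union>n. A n) = UNIV" and A: "\<And>n. A n \<in> I"
    by (auto simp: ideal_partitions_def)
  obtain a where a: "\<And>m. m \<in> A (a m)"
    using cover by (metis UNIV_I UN_E)
  then have iff: "m \<in> A k \<longleftrightarrow> a m = k" for m k
    using disj unfolding disjoint_family_on_def by blast
  have "{m. a m \<le> k} = (\<Union>j\<in>{..k}. A j)" for k
    by (auto simp: iff)
  then have "ideal_to_one I a"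
    unfolding ideal_to_one_def using ideal_UN_finite[OF assms, of "{.._}" A] A by simp
  moreover have "A = fibres a"
    by (auto simp: fibres_def iff)
  ultimately show "A \<in> fibres ` {a. ideal_to_one I a}"
    by blast
next
  fix A assume "A \<in> fibres ` {a. ideal_to_one I a}"
  then obtain a where "ideal_to_one I a" and A: "A = fibres a"
    by blast
  then have "A k \<in> I" for k
    using ideal_subset[OF assms, of "{m. a m \<le> k}" "A k"]
    by (auto simp: fibres_def ideal_to_one_def)
  then show "A \<in> ideal_partitions I"
    by (auto simp: ideal_partitions_def A fibres_def disjoint_family_on_def)
qed

lemma inj_fibres: "inj fibres"
proof (rule injI, rule ext)
  fix a b m assume "fibres a = fibres b"
  then have "m \<in> fibres b (a m)"
    by (metis (mono_tags) fibres_def mem_Collect_eq)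
  then show "a m = b m"
    by (simp add: fibres_def)
qed

text \<open>Turns the set that must lie outside \<open>I\<close> in \<open>lambda_witness\<close>
  into a pointwise comparison of the two index functions.\<close>

lemma fibres_below: "(\<Union>n. fibres b n \<inter> (\<Union>k<n. fibres a k)) = {m. a m < b m}"
  by (auto simp: fibres_def)

lemma lambda_witness_fibres_iff:
  assumes "ideal_on_omega I"
  shows "lambda_witness I (fibres ` H) \<longleftrightarrow> unbounded_family I H"
  unfolding lambda_witness_def unbounded_family_def ideal_partitions_eq[OF assms]
  by (auto simp: fibres_below inj_image_subset_iff[OF inj_fibres])

lemma lambda_witness_imp_unbounded_family:
  assumes "ideal_on_omega I" "lambda_witness I \<A>"
  obtains H where "unbounded_family I H" "|H| \<le>o |\<A>|"
proof -
  obtain H where H: "\<A> = fibres ` H"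
    using assms unfolding lambda_witness_def ideal_partitions_eq[OF assms(1)]
    by (meson subset_imageE)
  have "H = inv fibres ` \<A>"
    by (simp add: H image_comp inj_fibres)
  then have "|H| \<le>o |\<A>|"
    by (metis card_of_image)
  with that assms H show thesis
    by (simp add: lambda_witness_fibres_iff)
qed

text \<open>Diagonalisation: countably many functions have a common lower bound modulo
  \<open>I\<close>, formed by letting the \<open>j\<close>-th function take part only from height
  \<open>j\<close> on.\<close>

lemma uncountable_unbounded_family:
  assumes I: "ideal_on_omega I" and H: "unbounded_family I H"
  shows "uncountable H"
proof
  assume "countable H"
  \<comment> \<open>An inclusion in the range suffices, so the empty family is covered by
    enumerating the identity.\<close>
  obtain a :: "nat \<Rightarrow> nat \<Rightarrow> nat" where a: "H \<subseteq> range a" "\<And>i. ideal_to_one I (a i)"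
  proof (cases "H = {}")
    case True
    moreover have "ideal_to_one I id"
      by (simp add: ideal_to_one_def ideal_finite[OF I])
    ultimately show thesis
      using that[of "\<lambda>_. id"] by auto
  next
    case False
    then show thesis
      using \<open>countable H\<close> H that[of "from_nat_into H"]
      by (auto simp: unbounded_family_def from_nat_into)
  qed
  \<comment> \<open>Equivalently, \<open>b m\<close> is the minimum over \<open>j\<close> of
    \<open>max j (a j m)\<close>. Thus \<open>b m \<le> k\<close> involves only the functions up to
    index \<open>k\<close>, and \<open>b \<le> a i\<close> wherever \<open>a i\<close> is at least
    \<open>i\<close>.\<close>
  define b where "b m = (LEAST k. \<exists>j\<le>k. a j m \<le> k)" for m
  have "{m. b m \<le> k} \<subseteq> (\<Union>j\<in>{..k}. {m. a j m \<le> k})" for k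
  proof
    fix m assume "m \<in> {m. b m \<le> k}"
    moreover have "\<exists>j\<le>b m. a j m \<le> b m"
      unfolding b_def by (rule LeastI[of _ "a 0 m"]) auto
    ultimately show "m \<in> (\<Union>j\<in>{..k}. {m. a j m \<le> k})"
      by (auto intro: le_trans)
  qed
  moreover have "(\<Union>j\<in>{..k}. {m. a j m \<le> k}) \<in> I" for k
    using a(2) by (intro ideal_UN_finite[OF I]) (auto simp: ideal_to_one_def)
  ultimately have "ideal_to_one I b"
    unfolding ideal_to_one_def using ideal_subset[OF I] by blast
  moreover have "{m. a i m < b m} \<in> I" for i
  proof -
    have "{m. a i m < b m} \<subseteq> {m. a i m \<le> i}"
    proof
      fix m assume "m \<in> {m. a i m < b m}"
      moreover have "b m \<le> a i m" if "i \<le> a i m"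
        unfolding b_def using that by (auto intro: Least_le)
      ultimately show "m \<in> {m. a i m \<le> i}"
        by force
    qed
    then show ?thesis
      using a(2) ideal_subset[OF I] unfolding ideal_to_one_def by blast
  qed
  ultimately show False
    using H a(1) unfolding unbounded_family_def by blast
qed


section \<open>\<open>I\<close>QN-spaces\<close>

text \<open>Where \<open>b\<close> vanishes the right-hand side uses \<open>1 / 0 = 0\<close>; this happens only on a set in \<open>I\<close>.\<close>

lemma IQN_converges_iff:
  assumes I: "ideal_on_omega I"
  shows "IQN_converges I S f g \<longleftrightarrow>
    (\<exists>b. ideal_to_one I b \<and> (\<forall>x\<in>S. {n. 1 / real (b n) \<le> \<bar>f n x - g x\<bar>} \<in> I))"
proof
  assume "IQN_converges I S f g"
  then obtain \<epsilon> :: "nat \<Rightarrow> real" where pos: "\<And>n. \<epsilon> n > 0" and conv: "ideal_convergent I \<epsilon> 0"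
    and f: "\<And>x. x \<in> S \<Longrightarrow> {n. \<bar>f n x - g x\<bar> \<ge> \<epsilon> n} \<in> I"
    unfolding IQN_converges_def by blast
  \<comment> \<open>Rounding down gives \<open>\<epsilon> n \<le> 1 / b n\<close> when
    \<open>b n > 0\<close>, so the exceptional sets can only shrink there, while
    \<open>1 / \<epsilon> n < b n + 1\<close> keeps the fibres of \<open>b\<close> in
    \<open>I\<close>.\<close>
  define b where "b n = nat \<lfloor>1 / \<epsilon> n\<rfloor>" for n
  have b: "real (b n) \<le> 1 / \<epsilon> n" "1 / \<epsilon> n < real (b n) + 1" for n
    using pos[of n] unfolding b_def by (auto simp: less_imp_le)
  have "{n. b n \<le> k} \<in> I" for k
  proof (rule ideal_subset[OF I])
    show "{n. \<bar>\<epsilon> n - 0\<bar> \<ge> 1 / (real k + 1)} \<in> I"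
      using conv unfolding ideal_convergent_def by simp
    show "{n. b n \<le> k} \<subseteq> {n. \<bar>\<epsilon> n - 0\<bar> \<ge> 1 / (real k + 1)}"
    proof safe
      fix n assume "b n \<le> k"
      then have "1 / \<epsilon> n \<le> real k + 1"
        using b(2)[of n] by linarith
      then show "\<bar>\<epsilon> n - 0\<bar> \<ge> 1 / (real k + 1)"
        using pos[of n] by (simp add: field_simps)
    qed
  qed
  then have "ideal_to_one I b"
    by (simp add: ideal_to_one_def)
  moreover have "{n. 1 / real (b n) \<le> \<bar>f n x - g x\<bar>} \<in> I" if "x \<in> S" for x
  proof (rule ideal_subset[OF I])
    show "{n. b n \<le> 0} \<union> {n. \<bar>f n x - g x\<bar> \<ge> \<epsilon> n} \<in> I"
      using \<open>ideal_to_one I b\<close> f[OF that] ideal_Un[OF I] unfolding ideal_to_one_def by blast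
    have "\<epsilon> n \<le> 1 / real (b n)" if "0 < b n" for n
      using b(1)[of n] pos[of n] that by (simp add: field_simps)
    then show "{n. 1 / real (b n) \<le> \<bar>f n x - g x\<bar>} \<subseteq> {n. b n \<le> 0} \<union> {n. \<bar>f n x - g x\<bar> \<ge> \<epsilon> n}"
      by force
  qed
  ultimately show "\<exists>b. ideal_to_one I b \<and> (\<forall>x\<in>S. {n. 1 / real (b n) \<le> \<bar>f n x - g x\<bar>} \<in> I)"
    by blast
next
  assume "\<exists>b. ideal_to_one I b \<and> (\<forall>x\<in>S. {n. 1 / real (b n) \<le> \<bar>f n x - g x\<bar>} \<in> I)"
  then obtain b where b: "\<And>k. {n. b n \<le> k} \<in> I"
    and f: "\<And>x. x \<in> S \<Longrightarrow> {n. 1 / real (b n) \<le> \<bar>f n x - g x\<bar>} \<in> I"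
    unfolding ideal_to_one_def by blast
  \<comment> \<open>The value 1 keeps \<open>\<epsilon>\<close> positive on the zero set of
    \<open>b\<close>, which belongs to \<open>I\<close>.\<close>
  define \<epsilon> where "\<epsilon> n = (if b n = 0 then 1 else 1 / real (b n))" for n
  have "{n. \<bar>\<epsilon> n - 0\<bar> \<ge> e} \<in> I" if "e > 0" for e
  proof (rule ideal_subset[OF I b])
    show "{n. \<bar>\<epsilon> n - 0\<bar> \<ge> e} \<subseteq> {n. b n \<le> nat \<lceil>1 / e\<rceil>}"
    proof safe
      fix n assume "\<bar>\<epsilon> n - 0\<bar> \<ge> e"
      then have "real (b n) \<le> 1 / e"
        using that by (auto simp: \<epsilon>_def field_simps split: if_splits)
      then show "b n \<le> nat \<lceil>1 / e\<rceil>"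
        by linarith
    qed
  qed
  moreover have "{n. \<bar>f n x - g x\<bar> \<ge> \<epsilon> n} \<in> I" if "x \<in> S" for x
    by (rule ideal_subset[OF I ideal_Un[OF I b[of 0] f[OF that]]])
       (auto simp: \<epsilon>_def split: if_splits)
  ultimately show "IQN_converges I S f g"
    unfolding IQN_converges_def ideal_convergent_def
    by (intro exI[of _ \<epsilon>]) (auto simp: \<epsilon>_def)
qed

text \<open>Fix one sequence \<open>f\<close> refuting the property for the whole space. Each piece
  \<open>Y\<close> supplies a rate \<open>a Y\<close>, and a common lower bound of these rates
  modulo \<open>I\<close> would be a rate on the whole space.\<close>

lemma add_IQN_witness_imp_unbounded_family:
  assumes I: "ideal_on_omega I" and "add_IQN_witness I \<X>"
  obtains H where "unbounded_family I H" "|H| \<le>o |\<X>|"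
proof -
  obtain X where X: "topspace X = \<Union>\<X>" "\<not> IQN_space I X"
    and sub: "\<And>Y. Y \<in> \<X> \<Longrightarrow> IQN_space I (subtopology X Y)"
    using assms(2) unfolding add_IQN_witness_def by auto
  obtain f where f: "\<And>n. continuous_map X euclideanreal (f n)"
    "\<And>x. x \<in> topspace X \<Longrightarrow> (\<lambda>n. f n x) \<longlonglongrightarrow> 0"
    "\<not> IQN_converges I (topspace X) f (\<lambda>_. 0)"
    using X(2) unfolding IQN_space_def by auto
  have "\<exists>a. ideal_to_one I a \<and> (\<forall>x\<in>Y. {n. 1 / real (a n) \<le> \<bar>f n x - 0\<bar>} \<in> I)"
    if "Y \<in> \<X>" for Y
  proof -
    have "topspace (subtopology X Y) = Y"
      using X(1) that by auto
    then have "IQN_converges I Y f (\<lambda>_. 0)"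
      using sub[OF that] f X(1) that unfolding IQN_space_def
      by (metis UnionI continuous_map_from_subtopology)
    then show ?thesis
      by (simp only: IQN_converges_iff[OF I])
  qed
  then obtain a where a: "\<And>Y. Y \<in> \<X> \<Longrightarrow> ideal_to_one I (a Y)"
    "\<And>Y x. Y \<in> \<X> \<Longrightarrow> x \<in> Y \<Longrightarrow> {n. 1 / real (a Y n) \<le> \<bar>f n x - 0\<bar>} \<in> I"
    by metis
  have "\<exists>Y\<in>\<X>. {m. a Y m < b m} \<notin> I" if b: "ideal_to_one I b" for b
  proof (rule ccontr)
    assume "\<not> (\<exists>Y\<in>\<X>. {m. a Y m < b m} \<notin> I)"
    then have less: "\<And>Y. Y \<in> \<X> \<Longrightarrow> {m. a Y m < b m} \<in> I"
      by blast
    have "{n. 1 / real (b n) \<le> \<bar>f n x - 0\<bar>} \<in> I" if x: "x \<in> topspace X" for x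
    proof -
      obtain Y where Y: "Y \<in> \<X>" "x \<in> Y"
        using X(1) x by blast
      \<comment> \<open>Off this set \<open>0 < b n \<le> a Y n\<close>, so the bound valid on
        \<open>Y\<close> gives the one required for \<open>b\<close>.\<close>
      have "{n. b n \<le> 0} \<union> ({m. a Y m < b m} \<union> {n. 1 / real (a Y n) \<le> \<bar>f n x - 0\<bar>}) \<in> I"
        using b less[OF Y(1)] a(2)[OF Y] ideal_Un[OF I] unfolding ideal_to_one_def by blast
      moreover have "{n. 1 / real (b n) \<le> \<bar>f n x - 0\<bar>} \<subseteq>
          {n. b n \<le> 0} \<union> ({m. a Y m < b m} \<union> {n. 1 / real (a Y n) \<le> \<bar>f n x - 0\<bar>})"
      proof
        fix n assume n: "n \<in> {n. 1 / real (b n) \<le> \<bar>f n x - 0\<bar>}"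
        have "1 / real (a Y n) \<le> 1 / real (b n)" if "0 < b n" "b n \<le> a Y n"
          using that by (simp add: frac_le)
        with n show "n \<in> {n. b n \<le> 0} \<union>
            ({m. a Y m < b m} \<union> {n. 1 / real (a Y n) \<le> \<bar>f n x - 0\<bar>})"
          by (simp only: Un_iff mem_Collect_eq) linarith
      qed
      ultimately show ?thesis
        by (rule ideal_subset[OF I])
    qed
    with b have "IQN_converges I (topspace X) f (\<lambda>_. 0)"
      using IQN_converges_iff[OF I] by blast
    with f(3) show False ..
  qed
  then have "unbounded_family I (a ` \<X>)"
    using a(1) unfolding unbounded_family_def by blast
  then show thesis
    using that card_of_image by blast
qed

section \<open>Discrete spaces covered by their points\<close>

lemma IQN_space_singleton:
  assumes I: "ideal_on_omega I" and "topspace X = {x}"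
  shows "IQN_space I X"
  unfolding IQN_space_def
proof (intro allI impI)
  fix f :: "nat \<Rightarrow> 'a \<Rightarrow> real"
  assume "(\<forall>n. continuous_map X euclideanreal (f n)) \<and>
    (\<forall>x\<in>topspace X. (\<lambda>n. f n x) \<longlonglongrightarrow> 0)"
  then have lim: "(\<lambda>n. f n x) \<longlonglongrightarrow> 0"
    using assms by simp
  \<comment> \<open>At a single point the values themselves serve as control sequence; the added
    term makes it positive and the inequality strict, so the exceptional sets are empty.\<close>
  define \<epsilon> where "\<epsilon> n = \<bar>f n x\<bar> + 1 / real (Suc n)" for n
  have "(\<lambda>n. \<bar>f n x\<bar>) \<longlonglongrightarrow> 0"
    using lim by (rule tendsto_rabs_zero)
  from tendsto_add[OF this LIMSEQ_inverse_real_of_nat] have "\<epsilon> \<longlonglongrightarrow> 0"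
    by (simp add: \<epsilon>_def[abs_def] inverse_eq_divide)
  have "{n. \<bar>\<epsilon> n - 0\<bar> \<ge> e} \<in> I" if "e > 0" for e
  proof -
    have "\<forall>\<^sub>F n in sequentially. \<bar>\<epsilon> n - 0\<bar> < e"
      using tendstoD[OF \<open>\<epsilon> \<longlonglongrightarrow> 0\<close> that] by (simp add: dist_real_def)
    then show ?thesis
      by (intro ideal_finite[OF I])
         (simp add: eventually_cofinite not_less flip: cofinite_eq_sequentially)
  qed
  moreover have "\<epsilon> n > \<bar>f n x - 0\<bar>" for n
    by (simp add: \<epsilon>_def)
  then have "\<forall>n. \<epsilon> n > 0" "\<forall>y\<in>topspace X. {n. \<bar>f n y - 0\<bar> \<ge> \<epsilon> n} = {}"
    using assms(2) by (auto simp: not_le intro: le_less_trans[OF abs_ge_zero])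
  ultimately show "IQN_converges I (topspace X) f (\<lambda>_. 0)"
    unfolding IQN_converges_def ideal_convergent_def
    using ideal_finite[OF I, of "{}"] by (intro exI[of _ \<epsilon>]) simp
qed

lemma perfectly_normal_discrete: "perfectly_normal_space (discrete_topology U)"
  unfolding perfectly_normal_space_def
  by (auto intro: open_imp_gdelta_in Hausdorff_imp_t1_space simp: normal_space_discrete_topology Hausdorff_space_discrete_topology)

text \<open>A function is coded by its graph, which the pairing function turns into a subset of
  \<nat>.\<close>

lemma card_Baire_le_real: "|UNIV :: (nat \<Rightarrow> nat) set| \<le>o |UNIV :: real set|"
proof -
  have "inj (\<lambda>g :: nat \<Rightarrow> nat. prod_encode ` {(n, g n) |n. True})"
  proof (rule injI)
    fix g h :: "nat \<Rightarrow> nat"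
    assume "prod_encode ` {(n, g n) |n. True} = prod_encode ` {(n, h n) |n. True}"
    then have "{(n, g n) |n. True} = {(n, h n) |n. True}"
      by (simp add: inj_image_eq_iff[OF inj_prod_encode])
    then show "g = h"
      by blast
  qed
  then have "|UNIV :: (nat \<Rightarrow> nat) set| \<le>o |UNIV :: nat set set|"
    using card_of_ordLeq by blast
  also have "|UNIV :: nat set set| \<le>o |UNIV :: real set|"
    using nat_sets_eqpoll_reals eqpoll_imp_lepoll card_of_ordLeq unfolding lepoll_def by blast
  finally show ?thesis .
qed

text \<open>The members of \<open>H\<close> become the points of a discrete space, and the
  \<open>n\<close>-th map evaluates the reciprocal of \<open>h n + 1\<close>. Finite-to-one
  functions give pointwise convergence to 0, while a rate of convergence would be a lower bound of
  \<open>H\<close> modulo \<open>I\<close>.\<close>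

lemma finite_to_one_family_imp_add_IQN_witness:
  assumes univ: "|UNIV :: real set| \<le>o |UNIV :: 'a set|"
    and I: "ideal_on_omega I" and H: "unbounded_family I H"
    and fin: "\<And>h k. h \<in> H \<Longrightarrow> finite {m. h m \<le> k}"
  obtains \<X> :: "'a set set" where "add_IQN_witness I \<X>" "|\<X>| \<le>o |H|"
proof -
  obtain e :: "(nat \<Rightarrow> nat) \<Rightarrow> 'a" where e: "inj e"
    using ordLeq_transitive[OF card_Baire_le_real univ] card_of_ordLeq[of UNIV UNIV]
    by metis
  define X where "X = discrete_topology (e ` H)"
  \<comment> \<open>The summand 1 avoids division by zero and makes \<open>h m < b m\<close> imply
    \<open>1 / b m \<le> 1 / (h m + 1)\<close>.\<close>
  define f where "f n x = 1 / (real (inv e x n) + 1)" for n x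
  have "\<not> IQN_converges I (topspace X) f (\<lambda>_. 0)"
  proof
    assume "IQN_converges I (topspace X) f (\<lambda>_. 0)"
    then obtain b where b: "ideal_to_one I b"
      and f: "\<And>x. x \<in> e ` H \<Longrightarrow> {n. 1 / real (b n) \<le> \<bar>f n x - 0\<bar>} \<in> I"
      unfolding IQN_converges_iff[OF I] X_def by auto
    have "{m. h m < b m} \<in> I" if "h \<in> H" for h
    proof (rule ideal_subset[OF I f])
      show "e h \<in> e ` H"
        using that by simp
      show "{m. h m < b m} \<subseteq> {n. 1 / real (b n) \<le> \<bar>f n (e h) - 0\<bar>}"
        by (auto simp: f_def e intro!: divide_left_mono)
    qed
    with H b show False
      unfolding unbounded_family_def by blast
  qed
  moreover have "(\<lambda>n. f n x) \<longlonglongrightarrow> 0" if x: "x \<in> topspace X" for x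
  proof -
    obtain h where h: "h \<in> H" "x = e h"
      using x unfolding X_def by auto
    have "filterlim h at_top sequentially"
      unfolding filterlim_at_top
    proof
      fix k
      have "finite {m. \<not> k \<le> h m}"
        using fin[OF h(1), of k] by (rule rev_finite_subset) auto
      then show "\<forall>\<^sub>F m in sequentially. k \<le> h m"
        by (simp add: eventually_cofinite flip: cofinite_eq_sequentially)
    qed
    then have "(\<lambda>n. inverse (real (Suc (h n)))) \<longlonglongrightarrow> 0"
      by (rule filterlim_compose[OF LIMSEQ_inverse_real_of_nat])
    then show ?thesis
      by (simp add: f_def h e inverse_eq_divide add.commute)
  qed
  ultimately have "\<not> IQN_space I X"
    unfolding IQN_space_def X_def by auto
  moreover have "IQN_space I (subtopology X {e h})" if "h \<in> H" for h
    using that by (intro IQN_space_singleton[OF I, of _ "e h"]) (auto simp: X_def)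
  ultimately have "add_IQN_witness I ((\<lambda>h. {e h}) ` H)"
    unfolding add_IQN_witness_def
    by (intro exI[of _ X]) (auto simp: X_def perfectly_normal_discrete)
  then show thesis
    using that card_of_image by blast
qed


section \<open>Bounding and dominating families\<close>

text \<open>The summand \<open>k\<close> makes the set nonempty.\<close>

definition pseudo_inverse :: "(nat \<Rightarrow> nat) \<Rightarrow> nat \<Rightarrow> nat" where
  "pseudo_inverse g m = (LEAST k. m \<le> g k + k)"

lemma pseudo_inverse_le: "m \<le> g k + k \<Longrightarrow> pseudo_inverse g m \<le> k"
  unfolding pseudo_inverse_def by (rule Least_le)

lemma finite_pseudo_inverse: "finite {m. pseudo_inverse g m \<le> k}"
proof (rule finite_subset)
  have "m \<le> g (pseudo_inverse g m) + pseudo_inverse g m" for m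
    unfolding pseudo_inverse_def by (rule LeastI[of _ m]) simp
  then show "{m. pseudo_inverse g m \<le> k} \<subseteq> (\<Union>j\<le>k. {..g j + j})"
    by auto
qed simp

lemma ideal_to_one_pseudo_inverse: "ideal_on_omega I \<Longrightarrow> ideal_to_one I (pseudo_inverse g)"
  by (simp add: ideal_to_one_def ideal_finite finite_pseudo_inverse)

text \<open>The weak P-property makes a given \<open>b\<close> finite-to-one on some
  \<open>A\<close> outside \<open>I\<close>. If \<open>f\<close> dominates the function measuring
  how far the fibres of \<open>b\<close> extend inside \<open>A\<close>, then
  \<open>pseudo_inverse f < b\<close> on \<open>A\<close> up to a set in \<open>I\<close>.\<close>

lemma unbounded_family_of_dominating:
  assumes I: "weak_P_ideal I" and F: "\<forall>g. \<exists>f\<in>F. eventually_le g f"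
  shows "unbounded_family I (pseudo_inverse ` F)"
  unfolding unbounded_family_def
proof (intro conjI ballI allI impI)
  have ideal: "ideal_on_omega I"
    using I by (simp add: weak_P_ideal_def)
  show "ideal_to_one I a" if "a \<in> pseudo_inverse ` F" for a
    using that ideal_to_one_pseudo_inverse[OF ideal] by blast
  fix b assume b: "ideal_to_one I b"
  then have "fibres b \<in> ideal_partitions I"
    by (simp add: ideal_partitions_eq[OF ideal])
  then obtain A where A: "A \<notin> I" "\<And>k. finite (fibres b k \<inter> A)"
    using I unfolding weak_P_ideal_def by blast
  \<comment> \<open>The fibre over \<open>k + 1\<close> is recorded at \<open>k\<close>, so that a
    bound \<open>pseudo_inverse f m \<le> k\<close> is strictly below \<open>b m\<close>.\<close>
  define g where "g k = Max (insert 0 (fibres b (Suc k) \<inter> A))" for k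
  obtain f where "f \<in> F" "eventually_le g f"
    using F by blast
  then obtain N where f: "f \<in> F" "\<And>k. k \<ge> N \<Longrightarrow> g k \<le> f k"
    unfolding eventually_le_def eventually_sequentially by blast
  have "A \<subseteq> {m. pseudo_inverse f m < b m} \<union> {m. b m \<le> N}"
  proof
    fix m assume "m \<in> A"
    show "m \<in> {m. pseudo_inverse f m < b m} \<union> {m. b m \<le> N}"
    proof (cases "b m \<le> N")
      case False
      then obtain k where k: "b m = Suc k" "k \<ge> N"
        by (metis Suc_le_D not_less_eq_eq)
      then have "m \<le> g k"
        unfolding g_def using A(2) \<open>m \<in> A\<close> by (intro Max_ge) (auto simp: fibres_def)
      also have "g k \<le> f k"
        using f(2) k(2) .
      finally show ?thesis
        using pseudo_inverse_le[of m f k] k(1) by simp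
    qed simp
  qed
  then have "{m. pseudo_inverse f m < b m} \<notin> I"
    using A(1) b ideal_Un[OF ideal] ideal_subset[OF ideal] unfolding ideal_to_one_def by blast
  then show "\<exists>a\<in>pseudo_inverse ` F. {m. a m < b m} \<notin> I"
    using f(1) by blast
qed

text \<open>By the P-property each \<open>a\<close> in \<open>H\<close> is finite-to-one off some
  \<open>A a\<close> in \<open>I\<close>, and \<open>G a\<close> bounds what is left of its initial
  segments. If \<open>g\<close> eventually bounded every \<open>G a\<close>, then
  \<open>pseudo_inverse g\<close> would be a lower bound of \<open>H\<close> modulo
  \<open>I\<close>.\<close>

lemma unbounded_of_unbounded_family:
  assumes I: "P_ideal I" and H: "unbounded_family I H"
  obtains G where "\<not> (\<exists>g. \<forall>f\<in>G. eventually_le f g)" "|G| \<le>o |H|"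
proof -
  have ideal: "ideal_on_omega I"
    using I by (simp add: P_ideal_def)
  have "\<exists>A\<in>I. \<forall>k. finite ({m. a m \<le> k} - A)" if "a \<in> H" for a
  proof -
    have "\<forall>k. {m. a m \<le> k} \<in> I"
      using H that by (simp add: unbounded_family_def ideal_to_one_def)
    then show ?thesis
      using I[unfolded P_ideal_def, THEN conjunct2, THEN spec[of _ "\<lambda>k. {m. a m \<le> k}"]] by simp
  qed
  then obtain A where A: "\<And>a. a \<in> H \<Longrightarrow> A a \<in> I"
    "\<And>a k. a \<in> H \<Longrightarrow> finite ({m. a m \<le> k} - A a)"
    by metis
  define G where "G a k = Max (insert 0 ({m. a m \<le> k} - A a))" for a k
  have "\<not> (\<exists>g. \<forall>f\<in>G ` H. eventually_le f g)"
  proof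
    assume "\<exists>g. \<forall>f\<in>G ` H. eventually_le f g"
    then obtain g where g: "\<And>a. a \<in> H \<Longrightarrow> eventually_le (G a) g"
      by blast
    have "{m. a m < pseudo_inverse g m} \<in> I" if a: "a \<in> H" for a
    proof -
      obtain N where N: "\<And>k. k \<ge> N \<Longrightarrow> G a k \<le> g k"
        using g[OF a] unfolding eventually_le_def eventually_sequentially by blast
      have "{m. a m < pseudo_inverse g m} \<subseteq> A a \<union> {m. a m \<le> N}"
      proof (rule ccontr)
        assume "\<not> ?thesis"
        then obtain m where m: "a m < pseudo_inverse g m" "m \<notin> A a" "\<not> a m \<le> N"
          by blast
        have "m \<le> G a (a m)"
          unfolding G_def using A(2)[OF a] m(2) by (intro Max_ge) auto
        then have "pseudo_inverse g m \<le> a m"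
          using N[of "a m"] m(3) by (intro pseudo_inverse_le) simp
        with m(1) show False
          by simp
      qed
      moreover have "A a \<union> {m. a m \<le> N} \<in> I"
        using A(1) H a ideal_Un[OF ideal] unfolding unbounded_family_def ideal_to_one_def by blast
      ultimately show ?thesis
        using ideal_subset[OF ideal] by blast
    qed
    then show False
      using H ideal_to_one_pseudo_inverse[OF ideal] unfolding unbounded_family_def by blast
  qed
  then show thesis
    using that card_of_image by blast
qed


section \<open>\<open>F\<^sub>\<sigma>\<close> ideals\<close>

lemma topspace_powerset_topology [simp]: "topspace powerset_topology = UNIV"
  by (simp add: powerset_topology_def topspace_pullback_topology)

lemma compact_space_powerset_topology: "compact_space powerset_topology"
proof -
  let ?B = "product_topology (\<lambda>_::nat. discrete_topology (UNIV :: bool set)) UNIV"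
  have "continuous_map ?B powerset_topology Collect"
    unfolding powerset_topology_def
    by (rule continuous_map_pullback') (auto simp: comp_def)
  moreover have "compact_space ?B"
    by (simp add: compact_space_product_topology compact_space_discrete_topology)
  ultimately have "compactin powerset_topology (Collect ` topspace ?B)"
    unfolding compact_space_def by (rule image_compactin[rotated])
  moreover have "A \<in> Collect ` topspace ?B" for A
    by (rule image_eqI[of _ _ "\<lambda>n. n \<in> A"]) simp_all
  then have "Collect ` topspace ?B = topspace powerset_topology"
    by auto
  ultimately show ?thesis
    unfolding compact_space_def by metis
qed

lemma clopen_powerset_topology:
  "closedin powerset_topology {A. n \<in> A}" "openin powerset_topology {A. n \<in> A}"
proof -
  let ?B = "product_topology (\<lambda>_::nat. discrete_topology (UNIV :: bool set)) UNIV"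
  have "continuous_map powerset_topology ?B (\<lambda>A n. n \<in> A)"
    unfolding powerset_topology_def
    using continuous_map_pullback[OF continuous_map_id] by (simp add: comp_def)
  then have cont: "continuous_map powerset_topology (discrete_topology UNIV) (\<lambda>A. n \<in> A)"
    by (simp add: continuous_map_componentwise_UNIV)
  show "closedin powerset_topology {A. n \<in> A}"
    using closedin_continuous_map_preimage[OF cont, of "{True}"] by simp
  show "openin powerset_topology {A. n \<in> A}"
    using openin_continuous_map_preimage[OF cont, of "{True}"] by simp
qed

text \<open>Only finitely many coordinates matter, so the set is a finite union of cylinders, each a
  finite intersection of clopen sets.\<close>

lemma closedin_powerset_topology_restrict:
  "closedin powerset_topology {A. P (A \<inter> {..n :: nat})}"
proof -
  have single: "closedin powerset_topology {A. A \<inter> {..n} = s}" if "s \<subseteq> {..n}" for s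
  proof -
    have "closedin powerset_topology (\<Inter>i\<in>{..n}. {A. i \<in> A \<longleftrightarrow> i \<in> s})"
    proof (rule closedin_Inter)
      fix S assume "S \<in> (\<lambda>i. {A. i \<in> A \<longleftrightarrow> i \<in> s}) ` {..n}"
      then obtain i where i: "S = {A. i \<in> A \<longleftrightarrow> i \<in> s}"
        by blast
      then have "S = {A. i \<in> A} \<or> S = UNIV - {A. i \<in> A}"
        by auto
      then show "closedin powerset_topology S"
        using clopen_powerset_topology[of i]
          closedin_diff[OF closedin_topspace[of powerset_topology]] by auto
    qed simp
    moreover have "(\<Inter>i\<in>{..n}. {A. i \<in> A \<longleftrightarrow> i \<in> s}) = {A. A \<inter> {..n} = s}"
      using that by auto
    ultimately show ?thesis
      by simp
  qed
  have "{A. P (A \<inter> {..n})} = (\<Union>s\<in>{s \<in> Pow {..n}. P s}. {A. A \<inter> {..n} = s})"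
    by auto
  moreover have "closedin powerset_topology \<dots>"
    by (rule closedin_Union) (auto simp: single)
  ultimately show ?thesis
    by simp
qed

text \<open>Otherwise, for every \<open>n\<close>, some member of \<open>K\<close> contains the part
  of \<open>D\<close> up to \<open>n\<close>. These closed sets of members decrease, and by
  compactness a common member would contain all of \<open>D\<close>.\<close>

lemma compact_family_finite_escape:
  assumes K: "closedin powerset_topology K" and D: "\<And>B. B \<in> K \<Longrightarrow> \<not> D \<subseteq> B"
  obtains s where "finite s" "s \<subseteq> D" "\<And>B. B \<in> K \<Longrightarrow> \<not> s \<subseteq> B"
proof (rule ccontr)
  assume "\<not> thesis"
  define C where "C n = K \<inter> {B. D \<inter> {..n} \<subseteq> B \<inter> {..n}}" for n
  have "(\<Inter>n. C n) \<noteq> {}"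
  proof (rule compact_space_imp_nest[OF compact_space_powerset_topology])
    show "closedin powerset_topology (C n)" for n
      unfolding C_def using K closedin_powerset_topology_restrict[of "\<lambda>t. D \<inter> {..n} \<subseteq> t" n]
      by (rule closedin_Int)
    show "C n \<noteq> {}" for n
      using that[of "D \<inter> {..n}"] \<open>\<not> thesis\<close> unfolding C_def by blast
    show "decseq C"
      unfolding decseq_def C_def by force
  qed
  then obtain B where B: "\<And>n. B \<in> C n"
    by blast
  then have "D \<subseteq> B"
    unfolding C_def by auto
  moreover have "B \<in> K"
    using B unfolding C_def by blast
  ultimately show False
    using D by blast
qed

text \<open>Write \<open>J\<close> as an increasing union of closed sets \<open>K k\<close>. Since
  \<open>J\<close> is proper, none of its members contains the complement of \<open>C k\<close>, so
  compactness gives a finite \<open>s k\<close> in that complement lying in no member of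
  \<open>K k\<close>. Each \<open>B\<close> in \<open>J\<close> belongs to \<open>K k\<close> for
  all large \<open>k\<close>.\<close>

lemma F_sigma_ideal_escape:
  assumes J: "F_sigma_ideal J" and C: "\<And>k. C k \<in> J"
  obtains s where "\<And>k :: nat. finite (s k)" "\<And>k. s k \<inter> C k = {}"
    "\<And>B. B \<in> J \<Longrightarrow> finite {k. s k \<subseteq> B}"
proof -
  have ideal: "ideal_on_omega J" and "fsigma_in powerset_topology J"
    using J by (auto simp: F_sigma_ideal_def)
  then obtain K where K: "\<And>n :: nat. closedin powerset_topology (K n)"
    "\<And>n. K n \<subseteq> K (Suc n)" "(\<Union>n. K n) = J"
    unfolding fsigma_in_ascending by blast
  have "\<exists>s. finite s \<and> s \<inter> C k = {} \<and> (\<forall>B\<in>K k. \<not> s \<subseteq> B)" for k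
  proof -
    have "\<not> - C k \<subseteq> B" if "B \<in> K k" for B
    proof
      assume "- C k \<subseteq> B"
      then have "C k \<union> B = UNIV"
        by blast
      moreover have "B \<in> J"
        using K(3) that by blast
      ultimately show False
        using ideal_Un[OF ideal C] ideal_UNIV[OF ideal] by metis
    qed
    then obtain s where "finite s" "s \<subseteq> - C k" "\<And>B. B \<in> K k \<Longrightarrow> \<not> s \<subseteq> B"
      using compact_family_finite_escape[OF K(1)] by metis
    then show ?thesis
      by blast
  qed
  then obtain s where s: "\<And>k. finite (s k)" "\<And>k. s k \<inter> C k = {}"
    "\<And>k B. B \<in> K k \<Longrightarrow> \<not> s k \<subseteq> B"
    by metis
  have "finite {k. s k \<subseteq> B}" if B: "B \<in> J" for B
  proof -
    obtain n where "B \<in> K n"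
      using K(3) B by blast
    then have "B \<in> K k" if "n \<le> k" for k
      using lift_Suc_mono_le[of K n k] K(2) that by blast
    then have "{k. s k \<subseteq> B} \<subseteq> {..<n}"
      using s(3) by (auto simp: not_le[symmetric])
    then show ?thesis
      using finite_subset by blast
  qed
  with s that show thesis
    by blast
qed

text \<open>Let \<open>s k\<close> escape the preimage of \<open>{m. b m \<le> k}\<close> under the
  Katetov map \<open>\<kappa>\<close>, and let \<open>g k\<close> bound the image of
  \<open>s k\<close>. Whenever \<open>g k < f k\<close>, all of \<open>s k\<close> is sent into the
  set where \<open>pseudo_inverse f < b\<close>. This happens for infinitely many \<open>k\<close>,
  so the preimage of that set is not in \<open>J\<close>.\<close>

lemma unbounded_family_of_unbounded:
  assumes I: "ideal_on_omega I" and J: "F_sigma_ideal J" and "katetov_below I J"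
    and F: "\<not> (\<exists>g. \<forall>f\<in>F. eventually_le f g)"
  shows "unbounded_family I (pseudo_inverse ` F)"
  unfolding unbounded_family_def
proof (intro conjI ballI allI impI)
  show "ideal_to_one I a" if "a \<in> pseudo_inverse ` F" for a
    using that ideal_to_one_pseudo_inverse[OF I] by blast
  fix b assume b: "ideal_to_one I b"
  obtain \<kappa> :: "nat \<Rightarrow> nat" where \<kappa>: "\<And>A. A \<in> I \<Longrightarrow> \<kappa> -` A \<in> J"
    using \<open>katetov_below I J\<close> unfolding katetov_below_def by blast
  obtain s where s: "\<And>k. finite (s k)" "\<And>k. s k \<inter> \<kappa> -` {m. b m \<le> k} = {}"
    "\<And>B. B \<in> J \<Longrightarrow> finite {k. s k \<subseteq> B}"
    using F_sigma_ideal_escape[OF J, of "\<lambda>k. \<kappa> -` {m. b m \<le> k}"] b \<kappa>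
    unfolding ideal_to_one_def by metis
  define g where "g k = Max (insert 0 (\<kappa> ` s k))" for k
  obtain f where f: "f \<in> F" "\<not> eventually_le f g"
    using F by blast
  have "s k \<subseteq> \<kappa> -` {m. pseudo_inverse f m < b m}" if "g k < f k" for k
  proof
    fix i assume i: "i \<in> s k"
    have "\<kappa> i \<le> g k"
      unfolding g_def using s(1) i by (intro Max_ge) auto
    then have "pseudo_inverse f (\<kappa> i) \<le> k"
      using that by (intro pseudo_inverse_le) simp
    moreover have "k < b (\<kappa> i)"
      using s(2)[of k] i by force
    ultimately show "i \<in> \<kappa> -` {m. pseudo_inverse f m < b m}"
      by simp
  qed
  then have "{k. \<not> f k \<le> g k} \<subseteq> {k. s k \<subseteq> \<kappa> -` {m. pseudo_inverse f m < b m}}"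
    by (simp only: not_le) blast
  moreover have "infinite {k. \<not> f k \<le> g k}"
    using f(2) by (simp add: eventually_le_def eventually_cofinite flip: cofinite_eq_sequentially)
  ultimately have "{m. pseudo_inverse f m < b m} \<notin> I"
    using s(3) \<kappa> finite_subset by blast
  then show "\<exists>a\<in>pseudo_inverse ` F. {m. a m < b m} \<notin> I"
    using f(1) by blast
qed

section \<open>Ideals defined by lower semicontinuous submeasures\<close>

lemma F_sigma_ideal_finite_submeasure:
  assumes \<phi>: "lsc_submeasure \<phi>" and "\<phi> UNIV = \<infinity>"
  shows "F_sigma_ideal {A. \<phi> A < \<infinity>}"
  unfolding F_sigma_ideal_def
proof
  have zero: "\<phi> {} = 0" and mono: "A \<subseteq> B \<Longrightarrow> \<phi> A \<le> \<phi> B" and sub: "\<phi> (A \<union> B) \<le> \<phi> A + \<phi> B"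
    and single: "\<phi> {n} < \<infinity>" and lim: "(\<lambda>n. \<phi> (A \<inter> {..n})) \<longlonglongrightarrow> \<phi> A" for A B n
    using \<phi> unfolding lsc_submeasure_def by (blast, metis sup.absorb2, blast+)
  have un: "\<phi> (A \<union> B) < \<infinity>" if "\<phi> A < \<infinity>" "\<phi> B < \<infinity>" for A B
    using that by (intro le_less_trans[OF sub]) simp
  have "\<phi> A < \<infinity>" if "finite A" for A
    using that
  proof (induction A rule: finite_induct)
    case (insert n A)
    then show ?case
      using un[of "{n}" A] single by simp
  qed (simp add: zero)
  then show "ideal_on_omega {A. \<phi> A < \<infinity>}"
    unfolding ideal_on_omega_def using assms(2) un le_less_trans[OF mono] by auto
  \<comment> \<open>Lower semicontinuity reduces an upper bound on the submeasure to conditions on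
    initial segments, each of which defines a closed set.\<close>
  have le_iff: "\<phi> A \<le> c \<longleftrightarrow> (\<forall>n. \<phi> (A \<inter> {..n}) \<le> c)" for A c
    using mono[of "A \<inter> {.._}" A] LIMSEQ_le_const2[OF lim[of A], of c]
    by (meson inf_le1 order_trans)
  have "closedin powerset_topology {A. \<phi> A \<le> of_nat N}" for N
  proof -
    have "closedin powerset_topology (\<Inter>n. {A. \<phi> (A \<inter> {..n}) \<le> of_nat N})"
      by (rule closedin_Inter) (auto intro: closedin_powerset_topology_restrict)
    moreover have "(\<Inter>n. {A. \<phi> (A \<inter> {..n}) \<le> of_nat N}) = {A. \<phi> A \<le> of_nat N}"
      using le_iff by blast
    ultimately show ?thesis
      by simp
  qed
  moreover have "{A. \<phi> A < \<infinity>} = (\<Union>N. {A. \<phi> A \<le> of_nat N})"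
  proof (intro equalityI subsetI)
    fix A assume "A \<in> {A. \<phi> A < \<infinity>}"
    then obtain N :: nat where "\<phi> A < of_nat N"
      using ennreal_Ex_less_of_nat by auto
    then show "A \<in> (\<Union>N. {A. \<phi> A \<le> of_nat N})"
      by (auto intro: less_imp_le)
  qed (auto intro: le_less_trans simp: of_nat_less_top)
  ultimately show "fsigma_in powerset_topology {A. \<phi> A < \<infinity>}"
    by (auto intro!: fsigma_in_Union intro: closed_imp_fsigma_in)
qed

text \<open>Some tail of a set in \<open>Exh \<phi>\<close> has submeasure below 1, and the
  remaining part is finite.\<close>

lemma Exh_subset_finite:
  assumes \<phi>: "lsc_submeasure \<phi>" and "\<phi> UNIV = \<infinity>"
  shows "Exh \<phi> \<subseteq> {A. \<phi> A < \<infinity>}"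
proof
  fix A assume "A \<in> Exh \<phi>"
  then have "(\<lambda>n. \<phi> (A \<inter> {n..})) \<longlonglongrightarrow> 0"
    by (simp add: Exh_def)
  then have "\<forall>\<^sub>F n in sequentially. \<phi> (A \<inter> {n..}) < 1"
    by (rule order_tendstoD) simp
  then obtain n where "\<phi> (A \<inter> {n..}) < 1"
    using eventually_happens by force
  then have tail: "A \<inter> {n..} \<in> {A. \<phi> A < \<infinity>}"
    using less_trans[of _ 1 "\<infinity> :: ennreal"] by simp
  have ideal: "ideal_on_omega {A. \<phi> A < \<infinity>}"
    using F_sigma_ideal_finite_submeasure[OF assms] by (simp add: F_sigma_ideal_def)
  have "A \<inter> {..<n} \<in> {A. \<phi> A < \<infinity>}"
    by (rule ideal_finite[OF ideal]) simp
  from ideal_Un[OF ideal this tail] show "A \<in> {A. \<phi> A < \<infinity>}"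
    by (rule ideal_subset[OF ideal]) auto
qed


section \<open>Comparison of the cardinal invariants\<close>

text \<open>Every cover witnessing add yields a \<open>lambda_witness\<close> of no larger size,
  giving existence and comparison together. All witnesses for lambda are uncountable, and the bound
  by \<open>omega_1\<close> passes upwards.\<close>

lemma lambda_exists_if_add_IQN_exists:
  assumes "ideal_on_omega I" "add_IQN_exists TYPE('a) I"
  shows "lambda_exists I" "lambda_inv I \<le>o add_IQN TYPE('a) I"
    "omega_1 \<le>o lambda_inv I" "omega_1 \<le>o add_IQN TYPE('a) I"
proof -
  have *: "\<exists>\<A>. lambda_witness I \<A> \<and> |\<A>| \<le>o |\<X>|" if "add_IQN_witness I \<X>" for \<X> :: "'a set set"
    using add_IQN_witness_imp_unbounded_family[OF assms(1) that]
    by (metis card_of_image lambda_witness_fibres_iff[OF assms(1)] ordLeq_transitive)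
  obtain \<X> :: "'a set set" where \<X>: "add_IQN_witness I \<X>"
    using assms(2) unfolding add_IQN_exists_def by blast
  with * obtain \<A> where \<A>: "lambda_witness I \<A>"
    by blast
  then show "lambda_exists I"
    unfolding lambda_exists_def by blast
  show le: "lambda_inv I \<le>o add_IQN TYPE('a) I"
    unfolding lambda_inv_def add_IQN_def using \<X> * by (rule min_card_mono)
  have "uncountable \<A>" if "lambda_witness I \<A>" for \<A>
    using lambda_witness_imp_unbounded_family[OF assms(1) that]
      uncountable_unbounded_family[OF assms(1)]
    by (metis countable_ordLeq)
  then show "omega_1 \<le>o lambda_inv I"
    unfolding lambda_inv_def using \<A> by (metis min_card_attained omega_1_le_card_of_iff)
  from this le show "omega_1 \<le>o add_IQN TYPE('a) I"
    by (rule ordLeq_transitive)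
qed

text \<open>Common to both upper bounds: \<open>P\<close> will be instantiated by "dominating" and
  by "unbounded", and pseudo-inverses are finite-to-one as the discrete-space construction
  requires.\<close>

lemma add_IQN_le:
  assumes univ: "|UNIV :: real set| \<le>o |UNIV :: 'a set|" and I: "ideal_on_omega I"
    and "P F0" and P: "\<And>F. P F \<Longrightarrow> unbounded_family I (pseudo_inverse ` F)"
  shows "add_IQN_exists TYPE('a) I" "add_IQN TYPE('a) I \<le>o min_card P"
proof -
  have *: "\<exists>\<X> :: 'a set set. add_IQN_witness I \<X> \<and> |\<X>| \<le>o |F|" if "P F" for F
  proof -
    have "finite {m. h m \<le> k}" if "h \<in> pseudo_inverse ` F" for h k
      using that finite_pseudo_inverse by blast
    then obtain \<X> :: "'a set set" where "add_IQN_witness I \<X>" "|\<X>| \<le>o |pseudo_inverse ` F|"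
      using finite_to_one_family_imp_add_IQN_witness[OF univ I P[OF \<open>P F\<close>]] by metis
    then show ?thesis
      using ordLeq_transitive card_of_image by blast
  qed
  show "add_IQN_exists TYPE('a) I"
    using * \<open>P F0\<close> unfolding add_IQN_exists_def by blast
  show "add_IQN TYPE('a) I \<le>o min_card P"
    unfolding add_IQN_def using \<open>P F0\<close> * by (rule min_card_mono)
qed

lemma add_IQN_le_dominating_number:
  assumes "|UNIV :: real set| \<le>o |UNIV :: 'a set|" "weak_P_ideal I"
  shows "add_IQN_exists TYPE('a) I" "add_IQN TYPE('a) I \<le>o dominating_number"
proof -
  have "\<forall>g. \<exists>f\<in>UNIV. eventually_le g f"
    unfolding eventually_le_def by (meson UNIV_I always_eventually order_refl)
  note * = add_IQN_le[where P = "\<lambda>F. \<forall>g. \<exists>f\<in>F. eventually_le g f", OF assms(1) _ this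
      unbounded_family_of_dominating[OF assms(2)], folded dominating_number_def]
  show "add_IQN_exists TYPE('a) I" "add_IQN TYPE('a) I \<le>o dominating_number"
    using * assms(2) unfolding weak_P_ideal_def by blast+
qed

lemma unbounded_UNIV: "\<not> (\<exists>g. \<forall>f\<in>UNIV. eventually_le f g)"
proof
  assume "\<exists>g. \<forall>f\<in>UNIV. eventually_le f g"
  then obtain g where "eventually_le (Suc \<circ> g) g"
    by blast
  then show False
    by (simp add: eventually_le_def not_less_eq_eq)
qed

lemma add_IQN_le_bounding_number:
  assumes "|UNIV :: real set| \<le>o |UNIV :: 'a set|"
    "ideal_on_omega I" "F_sigma_ideal J" "katetov_below I J"
  shows "add_IQN_exists TYPE('a) I" "add_IQN TYPE('a) I \<le>o bounding_number"
  unfolding bounding_number_def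
  by (rule add_IQN_le[where P = "\<lambda>F. \<not> (\<exists>g. \<forall>f\<in>F. eventually_le f g)", OF assms(1,2)
      unbounded_UNIV unbounded_family_of_unbounded[OF assms(2-4)]], assumption)+

lemma bounding_number_le_lambda_inv:
  assumes "P_ideal I" "lambda_exists I"
  shows "bounding_number \<le>o lambda_inv I"
proof -
  have ideal: "ideal_on_omega I"
    using assms(1) by (simp add: P_ideal_def)
  have "\<exists>G. \<not> (\<exists>g. \<forall>f\<in>G. eventually_le f g) \<and> |G| \<le>o |\<A>|" if "lambda_witness I \<A>" for \<A>
    using lambda_witness_imp_unbounded_family[OF ideal that]
      unbounded_of_unbounded_family[OF assms(1)]
    by (metis (no_types, lifting) ordLeq_transitive)
  moreover obtain \<A> where "lambda_witness I \<A>"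
    using assms(2) unfolding lambda_exists_def by blast
  ultimately show ?thesis
    unfolding bounding_number_def lambda_inv_def by (intro min_card_mono)
qed

text \<open>The cycle bounding number \<le> lambda \<le> add \<le> bounding number closes.\<close>

lemma invariants_eq_bounding_number:
  assumes "|UNIV :: real set| \<le>o |UNIV :: 'a set|"
    "P_ideal I" "F_sigma_ideal J" "katetov_below I J"
  shows "lambda_exists I \<and> add_IQN_exists TYPE('a) I \<and>
    lambda_inv I =o add_IQN TYPE('a) I \<and> add_IQN TYPE('a) I =o bounding_number"
proof -
  have ideal: "ideal_on_omega I"
    using assms(2) by (simp add: P_ideal_def)
  note add = add_IQN_le_bounding_number[OF assms(1) ideal assms(3,4)]
  note lam = lambda_exists_if_add_IQN_exists[OF ideal add(1)]
  note b = bounding_number_le_lambda_inv[OF assms(2) lam(1)]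
  show ?thesis
    using add lam(1,2) b by (meson ordIso_iff_ordLeq ordLeq_transitive)
qed

theorem corollary4p7:
  assumes universe: "|UNIV :: real set| \<le>o |UNIV :: 'a set|"
  shows
    "(\<forall>I. weak_P_ideal I \<longrightarrow>
        lambda_exists I \<and> add_IQN_exists TYPE('a) I \<and>
        omega_1 \<le>o lambda_inv I \<and>
        lambda_inv I \<le>o add_IQN TYPE('a) I \<and>
        add_IQN TYPE('a) I \<le>o dominating_number) \<and>
     (\<forall>I J. ideal_on_omega I \<and> F_sigma_ideal J \<and> katetov_below I J \<longrightarrow>
        add_IQN_exists TYPE('a) I \<and>
        omega_1 \<le>o add_IQN TYPE('a) I \<and>
        add_IQN TYPE('a) I \<le>o bounding_number) \<and>
     (\<forall>I J. P_ideal I \<and> F_sigma_ideal J \<and> katetov_below I J \<longrightarrow>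
        lambda_exists I \<and> add_IQN_exists TYPE('a) I \<and>
        lambda_inv I =o add_IQN TYPE('a) I \<and>
        add_IQN TYPE('a) I =o bounding_number) \<and>
     (\<forall>I. analytic_ideal I \<and> P_ideal I \<and> generated_by_unbounded_submeasure I \<longrightarrow>
        lambda_exists I \<and> add_IQN_exists TYPE('a) I \<and>
        lambda_inv I =o add_IQN TYPE('a) I \<and>
        add_IQN TYPE('a) I =o bounding_number)"
proof (intro conjI[where P = "\<forall>I. _ I"] allI impI)
  fix I assume I: "weak_P_ideal I"
  then have "ideal_on_omega I"
    by (simp add: weak_P_ideal_def)
  then show "lambda_exists I \<and> add_IQN_exists TYPE('a) I \<and> omega_1 \<le>o lambda_inv I \<and>
      lambda_inv I \<le>o add_IQN TYPE('a) I \<and> add_IQN TYPE('a) I \<le>o dominating_number"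
    using add_IQN_le_dominating_number[OF universe I] lambda_exists_if_add_IQN_exists by blast
next
  fix I J assume "ideal_on_omega I \<and> F_sigma_ideal J \<and> katetov_below I J"
  then show "add_IQN_exists TYPE('a) I \<and> omega_1 \<le>o add_IQN TYPE('a) I \<and>
      add_IQN TYPE('a) I \<le>o bounding_number"
    using add_IQN_le_bounding_number[OF universe] lambda_exists_if_add_IQN_exists by blast
next
  fix I J assume "P_ideal I \<and> F_sigma_ideal J \<and> katetov_below I J"
  then show "lambda_exists I \<and> add_IQN_exists TYPE('a) I \<and>
      lambda_inv I =o add_IQN TYPE('a) I \<and> add_IQN TYPE('a) I =o bounding_number"
    using invariants_eq_bounding_number[OF universe] by blast
next
  fix I assume I: "analytic_ideal I \<and> P_ideal I \<and> generated_by_unbounded_submeasure I"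
  then obtain \<phi> where \<phi>: "lsc_submeasure \<phi>" "\<phi> UNIV = \<infinity>" "I = Exh \<phi>"
    unfolding generated_by_unbounded_submeasure_def by blast
  \<comment> \<open>The sets of finite submeasure form an \<open>F\<^sub>\<sigma>\<close> ideal
    containing \<open>I\<close>, so the identity is a Katetov reduction.\<close>
  then have "katetov_below I {A. \<phi> A < \<infinity>}"
    unfolding katetov_below_def using Exh_subset_finite[OF \<phi>(1,2)]
    by (intro exI[of _ id]) auto
  then show "lambda_exists I \<and> add_IQN_exists TYPE('a) I \<and>
      lambda_inv I =o add_IQN TYPE('a) I \<and> add_IQN TYPE('a) I =o bounding_number"
    using invariants_eq_bounding_number[OF universe _ F_sigma_ideal_finite_submeasure[OF \<phi>(1,2)]] I
    by blast
qed

end
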